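(* Let $v>k\geq 3$ be integers and let $D$ be a defining set for the full design $F(v,k)$. Then $$|D|\geq \binom{v}{k}\left[1-\frac{1+\sqrt{(32(v-k)+11)/3}}{2(v-k+1)}\right]=\binom{v}{k}\left(1-O\left((v-k)^{-1/2}\right)\right).$$
   Context: $N(v)=\{1,\dots,v\}$. A $(v,k,\lambda)$-design is a collection (repeated blocks allowed) of $k$-element subsets (blocks) of $N(v)$ such that each unordered pair of distinct elements of $N(v)$ lies in exactly $\lambda$ blocks. The full design $F(v,k)$ consists of all $k$-subsets of $N(v)$, each once; it is a $(v,k,\binom{v-2}{k-2})$-design. A subset $D\subseteq F(v,k)$ is a defining set for $F(v,k)$ if $F(v,k)$ is the only $(v,k,\binom{v-2}{k-2})$-design (repeated blocks allowed) containing $D$. $|D|$ is the number of blocks in $D$. *)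

theory Defs
  imports Complex_Main "HOL-Library.Multiset" "HOL-Library.Landau_Symbols"
begin

definition k_subsets :: "nat \<Rightarrow> nat \<Rightarrow> nat set set" where
  "k_subsets v k = {b. b \<subseteq> {1..v} \<and> card b = k}"

(* Repeated blocks are allowed, so a design is a multiset of blocks. *)
definition is_design :: "nat \<Rightarrow> nat \<Rightarrow> nat \<Rightarrow> nat set multiset \<Rightarrow> bool" where
  "is_design v k l B \<longleftrightarrow>
     set_mset B \<subseteq> k_subsets v k \<and>
     (\<forall>x\<in>{1..v}. \<forall>y\<in>{1..v}. x \<noteq> y \<longrightarrow> size {#b \<in># B. x \<in> b \<and> y \<in> b#} = l)"

definition full_design :: "nat \<Rightarrow> nat \<Rightarrow> nat set multiset" where
  "full_design v k = mset_set (k_subsets v k)"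

(* D is a subset of the full design, hence has no repeated blocks; it is contained
   in a multiset B iff mset_set D is a submultiset of B.  That the full design is
   itself a design containing D is automatic, see full_design_is_design and
   subset_full_design below. *)
definition defining_set :: "nat \<Rightarrow> nat \<Rightarrow> nat set set \<Rightarrow> bool" where
  "defining_set v k D \<longleftrightarrow>
     D \<subseteq> k_subsets v k \<and>
     (\<forall>B. is_design v k ((v - 2) choose (k - 2)) B \<and> mset_set D \<subseteq># B
        \<longrightarrow> B = full_design v k)"

lemma finite_k_subsets: "finite (k_subsets v k)"
  unfolding k_subsets_def by (rule finite_subset[of _ "Pow {1..v}"]) auto

lemma full_design_is_design:
  assumes "2 \<le> k"
  shows "is_design v k ((v - 2) choose (k - 2)) (full_design v k)"
proof -
  have "card {b \<in> k_subsets v k. x \<in> b \<and> y \<in> b} = (v - 2) choose (k - 2)"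
    if xy: "x \<in> {1..v}" "y \<in> {1..v}" "x \<noteq> y" for x y
  proof -
    let ?A = "{1..v} - {x, y}"
    have "bij_betw (\<lambda>c. insert x (insert y c)) {c. c \<subseteq> ?A \<and> card c = k - 2}
            {b \<in> k_subsets v k. x \<in> b \<and> y \<in> b}"
    proof (rule bij_betw_byWitness[where f' = "\<lambda>b. b - {x, y}"])
      show "(\<lambda>c. insert x (insert y c)) ` {c. c \<subseteq> ?A \<and> card c = k - 2}
              \<subseteq> {b \<in> k_subsets v k. x \<in> b \<and> y \<in> b}"
      proof (rule image_subsetI)
        fix c assume "c \<in> {c. c \<subseteq> ?A \<and> card c = k - 2}"
        then have c: "c \<subseteq> ?A" "card c = k - 2" by auto
        have "finite c" "x \<notin> c" "y \<notin> c" using c(1) finite_subset[of c ?A] by auto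
        then have "card (insert x (insert y c)) = k" using xy c(2) assms by simp
        then show "insert x (insert y c) \<in> {b \<in> k_subsets v k. x \<in> b \<and> y \<in> b}"
          using c(1) xy unfolding k_subsets_def by auto
      qed
      show "(\<lambda>b. b - {x, y}) ` {b \<in> k_subsets v k. x \<in> b \<and> y \<in> b}
              \<subseteq> {c. c \<subseteq> ?A \<and> card c = k - 2}"
      proof (rule image_subsetI)
        fix b assume "b \<in> {b \<in> k_subsets v k. x \<in> b \<and> y \<in> b}"
        then have b: "b \<subseteq> {1..v}" "card b = k" "{x, y} \<subseteq> b"
          unfolding k_subsets_def by auto
        have "card (b - {x, y}) = card b - card {x, y}"
          by (rule card_Diff_subset) (use b in simp_all)
        then show "b - {x, y} \<in> {c. c \<subseteq> ?A \<and> card c = k - 2}"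
          using b(1,2) xy(3) by auto
      qed
    next
      show "\<forall>c\<in>{c. c \<subseteq> ?A \<and> card c = k - 2}. insert x (insert y c) - {x, y} = c" by blast
      show "\<forall>b\<in>{b \<in> k_subsets v k. x \<in> b \<and> y \<in> b}. insert x (insert y (b - {x, y})) = b" by blast
    qed
    then have "card {b \<in> k_subsets v k. x \<in> b \<and> y \<in> b} = card {c. c \<subseteq> ?A \<and> card c = k - 2}"
      by (rule bij_betw_same_card[symmetric])
    also have "\<dots> = card ?A choose (k - 2)" by (rule n_subsets) simp
    also have "card ?A = card {1..v} - card {x, y}"
      by (rule card_Diff_subset) (use xy in simp_all)
    also have "\<dots> = v - 2" using xy(3) by simp
    finally show ?thesis .
  qed
  then show ?thesis
    using finite_k_subsets[of v k] unfolding is_design_def full_design_def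
    by (auto simp only: filter_mset_mset_set size_mset_set finite_set_mset_mset_set)
qed

lemma subset_full_design:
  assumes "D \<subseteq> k_subsets v k"
  shows "mset_set D \<subseteq># full_design v k"
  unfolding full_design_def using assms finite_k_subsets by (rule subset_imp_msubset_mset_set)

end

theory Submission
  imports Defs "HOL-Library.Disjoint_Sets"
begin

text \<open>Let \<open>C\<close> be the set of blocks missing from \<open>D\<close>. For points \<open>p \<noteq> q\<close> and a \<open>(k-3)\<close>-set \<open>R\<close>
  avoiding them, consider the graph on the remaining \<open>v-k+1\<close> points whose edges \<open>e\<close> satisfy
  \<open>R \<union> e \<union> {p} \<in> C\<close> and \<open>R \<union> e \<union> {q} \<in> C\<close>. A closed trail of even length in it would yield a
  trade that can be applied to the full design without touching \<open>D\<close>. Hence all its cycles are odd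
  and pairwise vertex-disjoint, so a graph on \<open>n\<close> vertices has at most \<open>n - 1 + n/3\<close> edges.
  Summing over \<open>R, p, q\<close> bounds the number of pairs of blocks of \<open>C\<close> sharing \<open>k-1\<close> points,
  and convexity turns this into a bound on the size of \<open>C\<close>.\<close>

section \<open>Walks as vertex lists, and their edges\<close>

fun walk_edges :: "'a list \<Rightarrow> 'a set list" where
  "walk_edges (x # y # zs) = {x, y} # walk_edges (y # zs)"
| "walk_edges _ = []"

lemma walk_edges_append:
  "xs \<noteq> [] \<Longrightarrow> ys \<noteq> [] \<Longrightarrow>
    walk_edges (xs @ ys) = walk_edges xs @ {last xs, hd ys} # walk_edges ys"
proof (induction xs rule: walk_edges.induct)
  case ("2_2" x)
  then show ?case by (cases ys) auto
qed auto

lemma walk_edges_join: "walk_edges (us @ p # vs) = walk_edges (us @ [p]) @ walk_edges (p # vs)"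
proof (cases vs)
  case (Cons w ws)
  then show ?thesis using walk_edges_append[of "us @ [p]" vs] by simp
qed simp

text \<open>The outer lists receive the ends of \<open>ts\<close> as shared vertices, so
  \<open>ts\<close> can be exchanged for another segment with the same ends without changing the
  outer edges.\<close>

lemma walk_edges_join3:
  assumes "ts \<noteq> []"
  shows "walk_edges (us @ ts @ vs) =
    walk_edges (us @ [hd ts]) @ walk_edges ts @ walk_edges (last ts # vs)"
proof -
  have "walk_edges (ts @ vs) = walk_edges ts @ walk_edges (last ts # vs)"
    using walk_edges_join[of "butlast ts" "last ts" vs] assms
    by (metis append.assoc append_Cons append_Nil append_butlast_last_id)
  moreover have "walk_edges (us @ ts @ vs) = walk_edges (us @ [hd ts]) @ walk_edges (ts @ vs)"
    using walk_edges_join[of us "hd ts" "tl ts @ vs"] assms by (cases ts) auto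
  ultimately show ?thesis by simp
qed

lemma walk_edges_rev: "walk_edges (rev xs) = rev (walk_edges xs)"
proof (induction xs rule: walk_edges.induct)
  case (1 x y zs)
  have "walk_edges (rev (x # y # zs)) = walk_edges (rev (y # zs)) @ [{y, x}]"
    using walk_edges_append[of "rev (y # zs)" "[x]"] by simp
  then show ?case using 1 by (simp add: insert_commute)
qed auto

lemma walk_edges_subset: "e \<in> set (walk_edges xs) \<Longrightarrow> e \<subseteq> set xs"
  by (induction xs rule: walk_edges.induct) auto

text \<open>The later endpoint of each edge lies in \<open>vs\<close>. Hence if \<open>vs\<close>
  avoids a set, the walk has no edge inside that set.\<close>

lemma walk_edges_meet_tl: "e \<in> set (walk_edges (q # vs)) \<Longrightarrow> e \<inter> set vs \<noteq> {}"
  by (induction vs arbitrary: q) auto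

lemma walk_edges_meet_butlast: "e \<in> set (walk_edges (us @ [p])) \<Longrightarrow> e \<inter> set us \<noteq> {}"
  using walk_edges_meet_tl[of e p "rev us"] walk_edges_rev[of "us @ [p]"] by simp

lemma distinct_walk_edges: "distinct xs \<Longrightarrow> distinct (walk_edges xs)"
proof (induction xs rule: walk_edges.induct)
  case (1 x y zs)
  then show ?case using walk_edges_subset[of "{x, y}" "y # zs"] by auto
qed auto

lemma length_walk_edges: "length (walk_edges xs) = length xs - 1"
  by (induction xs rule: walk_edges.induct) auto

section \<open>Trails, circuits and connectedness\<close>

text \<open>Vertices may repeat: going once round an odd cycle has to count as a trail from a vertex
  to itself.\<close>

definition trail :: "'a set set \<Rightarrow> 'a \<Rightarrow> 'a list \<Rightarrow> 'a \<Rightarrow> bool" where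
  "trail E a xs b \<longleftrightarrow> xs \<noteq> [] \<and> hd xs = a \<and> last xs = b \<and>
     distinct (walk_edges xs) \<and> set (walk_edges xs) \<subseteq> E"

lemma trail_mono: "trail E a xs b \<Longrightarrow> E \<subseteq> E' \<Longrightarrow> trail E' a xs b"
  unfolding trail_def by blast

lemma trail_rev: "trail E a xs b \<Longrightarrow> trail E b (rev xs) a"
  by (auto simp: trail_def walk_edges_rev hd_rev last_rev)

text \<open>A vertex list of odd length has an even number of edges.\<close>

definition even_circuit_free :: "'a set set \<Rightarrow> bool" where
  "even_circuit_free E \<longleftrightarrow> (\<forall>a xs. trail E a xs a \<longrightarrow> odd (length xs) \<longrightarrow> length xs = 1)"

text \<open>Vertex sets of odd cycles have this property, and it is all that is used of them.\<close>

definition both_parities :: "'a set set \<Rightarrow> 'a set \<Rightarrow> bool" where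
  "both_parities E K \<longleftrightarrow>
     (\<forall>p\<in>K. \<forall>q\<in>K. \<forall>c. \<exists>ts. trail E p ts q \<and> set ts \<subseteq> K \<and> even (length ts) = c)"

lemma both_parities_mono: "both_parities E K \<Longrightarrow> E \<subseteq> E' \<Longrightarrow> both_parities E' K"
  unfolding both_parities_def by (meson trail_mono)

text \<open>Edges are unordered, so the closure is symmetric. It is reflexive on the whole type, so
  singletons are connected even without edges.\<close>

definition joined :: "'a set set \<Rightarrow> ('a \<times> 'a) set" where
  "joined E = {(x, y). {x, y} \<in> E}\<^sup>*"

lemma joined_trans: "(x, y) \<in> joined E \<Longrightarrow> (y, z) \<in> joined E \<Longrightarrow> (x, z) \<in> joined E"
  unfolding joined_def by (rule rtrancl_trans)

lemma joined_edge: "{x, y} \<in> E \<Longrightarrow> (x, y) \<in> joined E"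
  unfolding joined_def by (rule r_into_rtrancl) simp

lemma joined_mono: "E \<subseteq> E' \<Longrightarrow> joined E \<subseteq> joined E'"
  unfolding joined_def by (rule rtrancl_mono) auto

text \<open>Induction along the closure: the path is extended by the next vertex, or cut back to it
  if it already lies on the path.\<close>

lemma joined_imp_path:
  assumes "(x, y) \<in> joined E"
  shows "\<exists>xs. trail E x xs y \<and> distinct xs"
  using assms unfolding joined_def
proof (induction rule: rtrancl_induct)
  case base
  have "trail E x [x] x \<and> distinct [x]" by (simp add: trail_def)
  then show ?case by blast
next
  case (step y z)
  then obtain xs where xs: "trail E x xs y" "distinct xs" by blast
  show ?case
  proof (cases "z \<in> set xs")
    case True
    then obtain us vs where sp: "xs = us @ z # vs" by (meson split_list)
    have "trail E x (us @ [z]) z \<and> distinct (us @ [z])"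
      using xs unfolding sp trail_def walk_edges_join[of us z vs]
      by (cases us) (auto simp: hd_append)
    then show ?thesis by blast
  next
    case False
    have "walk_edges (xs @ [z]) = walk_edges xs @ [{y, z}]"
      using walk_edges_append[of xs "[z]"] xs(1) by (auto simp: trail_def)
    moreover have "distinct (xs @ [z])" using xs False by simp
    ultimately have "trail E x (xs @ [z]) z \<and> distinct (xs @ [z])"
      using xs step(2) distinct_walk_edges[of "xs @ [z]"] by (auto simp: trail_def)
    then show ?thesis by blast
  qed
qed

text \<open>The edge \<open>{a, b}\<close> closes the path to a cycle with \<open>length xs\<close>
  edges. This number is odd, so the two arcs between two vertices differ in parity; for equal
  vertices the arcs are the trivial one and the whole cycle.\<close>

lemma both_parities_odd_cycle:
  assumes xs: "trail E a xs b" "distinct xs" and odd: "odd (length xs)" and new: "{a, b} \<notin> E"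
  shows "both_parities (insert {a, b} E) (set xs)"
proof -
  let ?E = "insert {a, b} E"
  have sub: "set (walk_edges xs) \<subseteq> E" using xs by (simp add: trail_def)
  have ordered: "\<exists>ts. trail ?E p ts q \<and> set ts \<subseteq> set xs \<and> even (length ts) = c"
    if sp: "xs = us @ ms @ vs" and ms: "ms \<noteq> []" "hd ms = p" "last ms = q" for us ms vs p q c
  proof -
    have we: "walk_edges xs = walk_edges (us @ [p]) @ walk_edges ms @ walk_edges (q # vs)"
      using walk_edges_join3[of ms us vs] ms sp by simp
    have dw: "distinct (walk_edges xs)" using xs by (simp add: trail_def)
    \<comment> \<open>The complementary arc: from \<open>p\<close> back to \<open>a\<close>, over
      the new edge to \<open>b\<close>, then back to \<open>q\<close>.\<close>
    let ?t = "rev (us @ [p]) @ rev (q # vs)"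
    have "last (rev (us @ [p])) = a" "hd (rev (q # vs)) = b"
      using xs(1) ms sp
      by (cases us; auto simp: trail_def last_rev hd_append hd_rev; fail)
        (use xs(1) ms sp in \<open>cases vs rule: rev_cases; auto simp: trail_def hd_rev\<close>)
    then have "walk_edges ?t = rev (walk_edges (us @ [p])) @ {a, b} # rev (walk_edges (q # vs))"
      using walk_edges_append[of "rev (us @ [p])" "rev (q # vs)"]
      by (simp only: walk_edges_rev) simp
    then have "trail ?E p ?t q"
      using we dw sub new unfolding trail_def by (auto simp: last_rev)
    moreover have "set ?t \<subseteq> set xs" using sp ms hd_in_set[of ms] last_in_set[of ms] by auto
    moreover have "trail ?E p ms q" using we dw sub ms by (auto simp: trail_def)
    moreover have "set ms \<subseteq> set xs" using sp by auto
    \<comment> \<open>The two lengths add up to \<open>length xs + 2\<close>, which is odd.\<close>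
    moreover have "even (length ms) \<noteq> even (length ?t)" using odd sp by auto
    ultimately show ?thesis by metis
  qed
  show ?thesis
    unfolding both_parities_def
  proof (intro ballI allI)
    fix p q c assume p: "p \<in> set xs" and q: "q \<in> set xs"
    obtain us ws where 1: "xs = us @ p # ws" using p by (meson split_list)
    show "\<exists>ts. trail ?E p ts q \<and> set ts \<subseteq> set xs \<and> even (length ts) = c"
    proof (cases "q \<in> set (p # ws)")
      case True
      then obtain ms vs where "p # ws = ms @ q # vs" by (meson split_list)
      then have "xs = us @ (ms @ [q]) @ vs" "hd (ms @ [q]) = p" using 1
        by (auto simp: hd_append Cons_eq_append_conv)
      then show ?thesis using ordered[of us "ms @ [q]" vs p q c] by simp
    next
      case False
      then have "q \<in> set us" using q 1 by auto
      then obtain us' ms where "us = us' @ q # ms" by (meson split_list)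
      then have "xs = us' @ (q # ms @ [p]) @ ws" using 1 by simp
      then obtain ts where "trail ?E q ts p \<and> set ts \<subseteq> set xs \<and> even (length ts) = c"
        using ordered[of us' "q # ms @ [p]" ws q p c] by auto
      then have "trail ?E p (rev ts) q \<and> set (rev ts) \<subseteq> set xs \<and> even (length (rev ts)) = c"
        using trail_rev by auto
      then show ?thesis by blast
    qed
  qed
qed

lemma closed_trail:
  assumes xs: "trail E a xs b" and new: "{a, b} \<notin> E"
  shows "trail (insert {a, b} E) a (xs @ [a]) a"
proof -
  have "walk_edges (xs @ [a]) = walk_edges xs @ [{a, b}]"
    using walk_edges_append[of xs "[a]"] xs by (auto simp: trail_def insert_commute)
  then show ?thesis using xs new by (auto simp: trail_def)
qed

text \<open>A path meeting \<open>K\<close> can be rerouted inside \<open>K\<close> so as to change the parity of its length,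
  so the edge closing the path produces a circuit of even length.\<close>

lemma both_parities_disjoint_path:
  assumes xs: "trail E a xs b" "distinct xs" and new: "{a, b} \<notin> E"
    and K: "both_parities E K" and free: "even_circuit_free (insert {a, b} E)"
  shows "set xs \<inter> K = {}"
proof (rule ccontr)
  assume "set xs \<inter> K \<noteq> {}"
  then have "\<exists>x\<in>set xs. x \<in> K" by blast
  \<comment> \<open>\<open>p\<close> and \<open>q\<close> will be the first and the last vertex of
    the path in \<open>K\<close>; they may coincide.\<close>
  then obtain us p ws where 1: "xs = us @ p # ws" "p \<in> K" "\<forall>x\<in>set us. x \<notin> K"
    using split_list_first_prop[of xs "\<lambda>x. x \<in> K"] by blast
  have "\<exists>x\<in>set (p # ws). x \<in> K" using 1 by simp
  then obtain ms q vs where 2: "p # ws = ms @ q # vs" "q \<in> K" "\<forall>x\<in>set vs. x \<notin> K"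
    using split_list_last_prop[of "p # ws" "\<lambda>x. x \<in> K"] by blast
  \<comment> \<open>The parity makes \<open>us @ ts @ vs\<close> even in length, so that closing it
    with \<open>{a, b}\<close> gives evenly many edges.\<close>
  obtain ts where ts: "trail E p ts q" "set ts \<subseteq> K"
    "even (length ts) = even (length us + length vs)"
    using K 1(2) 2(2) unfolding both_parities_def by meson
  have tsne: "ts \<noteq> []" "hd ts = p" "last ts = q" using ts by (auto simp: trail_def)
  have sp: "xs = us @ (ms @ [q]) @ vs" "hd (ms @ [q]) = p" using 1 2
    by (auto simp: hd_append Cons_eq_append_conv)
  have we: "walk_edges xs = walk_edges (us @ [p]) @ walk_edges (ms @ [q]) @ walk_edges (q # vs)"
    using walk_edges_join3[of "ms @ [q]" us vs] sp by simp
  let ?z = "us @ ts @ vs"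
  have wz: "walk_edges ?z = walk_edges (us @ [p]) @ walk_edges ts @ walk_edges (q # vs)"
    using walk_edges_join3[of ts us vs] tsne by simp
  \<comment> \<open>Edges of \<open>ts\<close> lie inside \<open>K\<close>, whereas each outer edge
    has an endpoint in \<open>us\<close> or \<open>vs\<close>, outside \<open>K\<close>.\<close>
  have "set (walk_edges (us @ [p])) \<inter> set (walk_edges ts) = {}"
    using walk_edges_meet_butlast[of _ us p] walk_edges_subset[of _ ts] 1(3) ts(2) by blast
  moreover have "set (walk_edges (q # vs)) \<inter> set (walk_edges ts) = {}"
    using walk_edges_meet_tl[of _ q vs] walk_edges_subset[of _ ts] 2(3) ts(2) by blast
  ultimately have "distinct (walk_edges ?z)" "set (walk_edges ?z) \<subseteq> E"
    using xs(1) ts(1) unfolding trail_def we wz by auto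
  moreover have "hd ?z = a" using xs(1) 1 tsne by (cases us) (auto simp: trail_def)
  moreover have "last ?z = b" using xs(1) sp tsne
    by (cases vs rule: rev_cases) (auto simp: trail_def)
  ultimately have "trail E a ?z b" using tsne by (simp add: trail_def)
  then have "trail (insert {a, b} E) a (?z @ [a]) a" using new by (rule closed_trail)
  moreover have "odd (length (?z @ [a]))" using ts(3) by (cases "even (length us)"; simp)
  ultimately have "length (?z @ [a]) = 1" using free unfolding even_circuit_free_def by blast
  then show False using tsne by simp
qed

section \<open>The number of edges of a graph without even circuits\<close>

text \<open>Edges are added one at a time. \<open>P\<close> consists of connected classes and
  \<open>KK\<close> of vertex sets of odd cycles. A new edge either merges two classes or closes a
  cycle that is odd and disjoint from the earlier ones. The inequality bounds the cyclomatic number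
  by \<open>card KK\<close>.\<close>

lemma even_circuit_free_structure:
  assumes "finite E" "finite V" "E \<subseteq> {e. e \<subseteq> V \<and> card e = 2}" "even_circuit_free E"
  shows "\<exists>P KK. partition_on V P \<and>
    (\<forall>p\<in>P. \<forall>x\<in>p. \<forall>y\<in>p. (x, y) \<in> joined E) \<and>
    disjoint KK \<and> (\<forall>K\<in>KK. K \<subseteq> V \<and> 3 \<le> card K \<and> both_parities E K) \<and>
    card E + card P \<le> card V + card KK"
  using assms(1,3,4)
proof (induction E rule: finite_induct)
  case empty
  let ?P = "(\<lambda>x. {x}) ` V"
  have "partition_on V ?P" by (auto simp: partition_on_def disjoint_def)
  moreover have "card ?P = card V" by (rule card_image) simp
  ultimately show ?case by - (rule exI[of _ ?P], rule exI[of _ "{}"], auto simp: joined_def)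
next
  case (insert f E)
  let ?E = "insert f E"
  have 1: "even_circuit_free E"
    using insert.prems(2) unfolding even_circuit_free_def
    by (meson subset_insertI trail_mono)
  have 2: "E \<subseteq> {e. e \<subseteq> V \<and> card e = 2}" using insert.prems(1) by blast
  obtain P KK where P: "partition_on V P"
    and "\<forall>p\<in>P. \<forall>x\<in>p. \<forall>y\<in>p. (x, y) \<in> joined E"
    and KK: "disjoint KK" and "\<forall>K\<in>KK. K \<subseteq> V \<and> 3 \<le> card K \<and> both_parities E K"
    and le: "card E + card P \<le> card V + card KK"
    using insert.IH[OF 2 1] by (elim exE conjE) (rule that)
  then have conn: "\<And>p x y. p \<in> P \<Longrightarrow> x \<in> p \<Longrightarrow> y \<in> p \<Longrightarrow> (x, y) \<in> joined E"
    and KK2: "\<And>K. K \<in> KK \<Longrightarrow> K \<subseteq> V \<and> 3 \<le> card K \<and> both_parities E K"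
    by simp_all
  obtain a b where f: "f = {a, b}" and ab: "a \<noteq> b" "a \<in> V" "b \<in> V"
    using insert.prems(1) by (auto simp: card_2_iff)
  have finP: "finite P" using P assms(2) by (rule finite_elements[rotated])
  obtain p q where pq: "p \<in> P" "a \<in> p" "q \<in> P" "b \<in> q"
    using ab partition_onD1[OF P] by blast
  have mono: "joined E \<subseteq> joined ?E"
    by (rule joined_mono) auto
  have KK': "K \<subseteq> V \<and> 3 \<le> card K \<and> both_parities ?E K" if "K \<in> KK" for K
    using KK2[OF that] by (meson both_parities_mono subset_insertI)
  have cE: "card ?E = Suc (card E)" using insert by simp
  show ?case
  proof (cases "p = q")
    \<comment> \<open>The edge joins two classes: one class is lost and \<open>KK\<close>
      stays.\<close>
    case False
    let ?Q = "insert (p \<union> q) (P - {p, q})"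
    let ?r = "joined ?E"
    have "partition_on V ?Q"
      using P pq unfolding partition_on_def disjoint_def by auto
    moreover have "(x, y) \<in> ?r" if "s \<in> ?Q" "x \<in> s" "y \<in> s" for s x y
    proof -
      have in_part: "(x, y) \<in> ?r" if "s \<in> P" "x \<in> s" "y \<in> s" for s x y
        using conn[OF that] mono by blast
      have e: "(a, b) \<in> ?r" "(b, a) \<in> ?r"
        by (rule joined_edge; simp add: f insert_commute)+
      have cross: "(x, y) \<in> ?r" "(y, x) \<in> ?r" if "x \<in> p" "y \<in> q" for x y
        using in_part[of p x a] in_part[of p a x] in_part[of q b y] in_part[of q y b] e pq that
        by (meson joined_trans)+
      show ?thesis using that in_part cross pq by blast
    qed
    moreover have "card ?Q \<le> Suc (card (P - {p, q}))" by (rule card_insert_le_m1) auto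
    moreover have "card (P - {p, q}) = card P - 2" "card P \<ge> 2"
      using card_Diff_subset[of "{p, q}" P] card_mono[of P "{p, q}"] pq False finP by auto
    ultimately show ?thesis
      using KK KK' le cE by - (rule exI[of _ ?Q], rule exI[of _ KK], auto)
  next
    \<comment> \<open>The edge closes a path inside one class: \<open>P\<close> stays and
      \<open>KK\<close> gains the vertex set of the new cycle.\<close>
    case True
    then obtain xs where xs: "trail E a xs b" "distinct xs"
      using joined_imp_path[OF conn[of p a b]] pq by blast
    have free: "even_circuit_free (insert {a, b} E)" using insert.prems f by simp
    have new: "{a, b} \<notin> E" using insert f by simp
    have "odd (length xs)"
    proof
      assume "even (length xs)"
      then have "length (xs @ [a]) = 1"
        using closed_trail[OF xs(1) new] free unfolding even_circuit_free_def
        by (metis even_Suc length_append_singleton)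
      then show False using xs by (simp add: trail_def)
    qed
    moreover have "length xs \<noteq> 1" using xs ab by (auto simp: trail_def length_Suc_conv)
    ultimately have len: "3 \<le> length xs" by presburger
    have disj: "set xs \<inter> K = {}" if "K \<in> KK" for K
      using both_parities_disjoint_path[OF xs new _ free] KK2[OF that] by blast
    have "both_parities ?E (set xs)"
      using both_parities_odd_cycle[OF xs \<open>odd (length xs)\<close> new] f by simp
    moreover have "3 \<le> card (set xs)" using len xs distinct_card by metis
    moreover have "set xs \<subseteq> V"
    proof
      fix x assume "x \<in> set xs"
      then obtain us vs where "xs = us @ x # vs" by (meson split_list)
      \<comment> \<open>A path with more than one vertex has an edge at each of its
        vertices.\<close>
      then have "\<exists>e\<in>set (walk_edges xs). x \<in> e"
        using len walk_edges_join[of us x vs] walk_edges_append[of us "[x]"]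
        by (cases vs; cases us) auto
      then show "x \<in> V" using xs(1) insert.prems(1) by (auto simp: trail_def)
    qed
    moreover have "disjoint (insert (set xs) KK)"
      using KK disj unfolding disjoint_def by blast
    moreover have "card (insert (set xs) KK) = Suc (card KK)"
    proof (rule card_insert_disjoint)
      show "finite KK" using KK2 assms(2) by (intro finite_subset[of KK "Pow V"]) auto
      show "set xs \<notin> KK" using disj len by force
    qed
    ultimately show ?thesis
      using P conn mono KK' le cE
      by - (rule exI[of _ P], rule exI[of _ "insert (set xs) KK"], auto)
  qed
qed

text \<open>Disjoint sets of at least three vertices number at most \<open>card V / 3\<close>, and a
  nonempty \<open>V\<close> has at least one class.\<close>

lemma even_circuit_free_card_edges:
  assumes "finite V" "V \<noteq> {}" "E \<subseteq> {e. e \<subseteq> V \<and> card e = 2}" "even_circuit_free E"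
  shows "3 * card E + 3 \<le> 4 * card V"
proof -
  have "E \<subseteq> Pow V" using assms(3) by auto
  then have "finite E" using assms(1) by (meson finite_Pow_iff finite_subset)
  obtain P KK where P: "partition_on V P" and KK: "disjoint KK"
    "\<forall>K\<in>KK. K \<subseteq> V \<and> 3 \<le> card K \<and> both_parities E K" and le: "card E + card P \<le> card V + card KK"
    using even_circuit_free_structure[OF \<open>finite E\<close> assms(1,3,4)] by (elim exE conjE) (rule that)
  have "3 * card KK \<le> (\<Sum>K\<in>KK. card K)"
    using sum_mono[of KK "\<lambda>_. 3" card] KK(2) by (simp add: mult.commute)
  also have "\<dots> = card (\<Union> KK)"
  proof (rule card_Union_disjoint[symmetric])
    show "disjoint KK" by (rule KK)
    show "finite K" if "K \<in> KK" for K using KK(2) assms(1) that by (meson finite_subset)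
  qed
  also have "\<dots> \<le> card V" using KK(2) assms(1) by (intro card_mono) auto
  finally have "3 * card KK \<le> card V" .
  moreover have "card P \<noteq> 0"
    using P assms(1,2) finite_elements[OF assms(1) P] by (auto simp: partition_on_def)
  ultimately show ?thesis using le by linarith
qed

section \<open>Trades from even circuits\<close>

text \<open>\<open>A\<close> and \<open>B\<close> take the edges alternately. Passing through a
  vertex uses one edge of each, so only the two ends contribute to the degree differences. On a
  closed trail of even length these contributions cancel as well.\<close>

lemma trail_alternating:
  assumes "distinct (walk_edges xs)" "xs \<noteq> []" "\<forall>e\<in>set (walk_edges xs). card e = 2"
  shows "\<exists>A B. A \<union> B = set (walk_edges xs) \<and> A \<inter> B = {} \<and>
    int (card A) - int (card B) = (if even (length xs) then 1 else 0) \<and>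
    (\<forall>z. int (card {e\<in>A. z \<in> e}) - int (card {e\<in>B. z \<in> e}) =
      (if z = hd xs then 1 else 0) + (- 1) ^ length xs * (if z = last xs then 1 else 0))"
  using assms
proof (induction xs rule: walk_edges.induct)
  case (1 x y zs)
  then obtain A B where AB: "A \<union> B = set (walk_edges (y # zs))" "A \<inter> B = {}"
    "int (card A) - int (card B) = (if even (length (y # zs)) then 1 else 0)" and
    deg: "\<And>z. int (card {e\<in>A. z \<in> e}) - int (card {e\<in>B. z \<in> e}) =
      (if z = y then 1 else 0) + (- 1) ^ length (y # zs) * (if z = last (y # zs) then 1 else 0)"
    by auto
  have fin: "finite A" "finite B" using AB(1) by (metis List.finite_set finite_Un)+
  have new: "{x, y} \<notin> A" "{x, y} \<notin> B" using AB(1) 1(2) by auto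
  have xy: "x \<noteq> y" using 1(4) by auto
  have "int (card {e\<in>insert {x, y} B. z \<in> e}) =
      int (card {e\<in>B. z \<in> e}) + (if z = x \<or> z = y then 1 else 0)" for z
  proof -
    have "{e\<in>insert {x, y} B. z \<in> e} =
        (if z = x \<or> z = y then insert {x, y} {e\<in>B. z \<in> e} else {e\<in>B. z \<in> e})" by auto
    then show ?thesis using fin new by simp
  qed
  then have "int (card {e\<in>insert {x, y} B. z \<in> e}) - int (card {e\<in>A. z \<in> e}) =
      (if z = hd (x # y # zs) then 1 else 0) +
      (- 1) ^ length (x # y # zs) * (if z = last (x # y # zs) then 1 else 0)" for z
    using deg[of z] xy by (auto split: if_splits)
  \<comment> \<open>The classes swap roles: the new first edge joins \<open>B\<close>, which then
    serves as the first class.\<close>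
  then show ?case using AB new fin
    by (intro exI[of _ "insert {x, y} B"] exI[of _ A]) auto
qed auto

text \<open>Exchanging \<open>N\<close> for \<open>P\<close> in the full design keeps
  \<open>D\<close> and all pair counts. The result is another design, in which the blocks of
  \<open>P\<close> occur twice and those of \<open>N\<close> not at all.\<close>

lemma no_trade:
  assumes k: "2 \<le> k" and D: "defining_set v k D"
    and P: "P \<subseteq> k_subsets v k" and N: "N \<subseteq> k_subsets v k" "N \<inter> D = {}" "N \<noteq> {}" "P \<inter> N = {}"
    and bal: "\<And>x y. x \<in> {1..v} \<Longrightarrow> y \<in> {1..v} \<Longrightarrow> x \<noteq> y \<Longrightarrow>
      card {b\<in>P. x \<in> b \<and> y \<in> b} = card {b\<in>N. x \<in> b \<and> y \<in> b}"
  shows False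
proof -
  let ?F = "k_subsets v k"
  let ?B = "mset_set (?F - N) + mset_set P"
  have fin: "finite ?F" "finite P" "finite N"
    using finite_k_subsets P N(1) by (auto intro: finite_subset)
  have "is_design v k ((v - 2) choose (k - 2)) ?B"
    unfolding is_design_def
  proof (intro conjI ballI impI)
    show "set_mset ?B \<subseteq> ?F" using P fin by auto
    fix x y assume xy: "x \<in> {1..v}" "y \<in> {1..v}" "x \<noteq> y"
    let ?c = "\<lambda>X. {b\<in>X. x \<in> b \<and> y \<in> b}"
    have "size {#b \<in># ?B. x \<in> b \<and> y \<in> b#} = card (?c (?F - N)) + card (?c P)"
      using fin by simp
    also have "\<dots> = card (?c (?F - N)) + card (?c N)" using bal[OF xy] by simp
    also have "\<dots> = card (?c (?F - N) \<union> ?c N)"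
      using fin by (intro card_Un_disjoint[symmetric]) auto
    also have "?c (?F - N) \<union> ?c N = ?c ?F" using N(1) by blast
    also have "card (?c ?F) = (v - 2) choose (k - 2)"
      using full_design_is_design[OF k, of v] xy fin unfolding is_design_def full_design_def
      by simp
    finally show "size {#b \<in># ?B. x \<in> b \<and> y \<in> b#} = (v - 2) choose (k - 2)" .
  qed
  moreover have "mset_set D \<subseteq># mset_set (?F - N)"
    using D N(2) fin unfolding defining_set_def by (intro subset_imp_msubset_mset_set) auto
  then have "mset_set D \<subseteq># ?B" using mset_subset_eq_add_left subset_mset.order_trans by blast
  ultimately have "?B = full_design v k" using D unfolding defining_set_def by blast
  moreover obtain b where "b \<in> N" using N(3) by blast
  ultimately show False
    using N(1,4) fin unfolding full_design_def by (metis (no_types, lifting) Diff_iff Un_iff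
      disjoint_iff finite_Diff finite_set_mset_mset_set set_mset_union subset_iff)
qed

text \<open>An alternating even circuit, multiplied by the difference of the points \<open>p\<close> and \<open>q\<close>,
  is a trade with coefficients in \<open>{-1, 0, 1}\<close>.\<close>

lemma link_even_circuit_free:
  assumes k: "3 \<le> k" and D: "defining_set v k D"
    and R: "R \<subseteq> {1..v}" "card R = k - 3"
    and pq: "p \<in> {1..v} - R" "q \<in> {1..v} - R" "p \<noteq> q"
  shows "even_circuit_free {e. e \<subseteq> {1..v} - R - {p, q} \<and> card e = 2 \<and>
    insert p (R \<union> e) \<notin> D \<and> insert q (R \<union> e) \<notin> D}"
    (is "even_circuit_free ?E")
  unfolding even_circuit_free_def
proof (intro allI impI, rule ccontr)
  fix a xs assume tr: "trail ?E a xs a" and odd: "odd (length xs)" and len: "length xs \<noteq> 1"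
  define f where "f i e = insert i (R \<union> e)" for i e
  define E where "E = ?E"
  have tr: "trail E a xs a" using tr unfolding E_def .
  have E_outside: "e \<subseteq> {1..v}" "e \<inter> R = {}" "p \<notin> e" "q \<notin> e" and E_card: "card e = 2"
    if "e \<in> E" for e
    using that unfolding E_def by blast+
  have E_notin: "f i e \<notin> D" if "e \<in> E" "i \<in> {p, q}" for e i
    using that unfolding E_def f_def by blast
  have walk_ne: "set (walk_edges xs) \<noteq> {}"
    using length_walk_edges[of xs] tr odd len by (cases xs) (auto simp: trail_def)
  have circ: "distinct (walk_edges xs)" "xs \<noteq> []" "\<forall>e\<in>set (walk_edges xs). card e = 2"
    using tr E_card unfolding trail_def by blast+
  obtain A B where AB: "A \<union> B = set (walk_edges xs)" "A \<inter> B = {}"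
    "int (card A) - int (card B) = (if even (length xs) then 1 else 0)" and
    deg: "\<forall>z. int (card {e\<in>A. z \<in> e}) - int (card {e\<in>B. z \<in> e}) =
      (if z = hd xs then 1 else 0) + (- 1) ^ length xs * (if z = last xs then 1 else 0)"
    using trail_alternating[OF circ] by (elim exE conjE) (rule that)
  have ne: "A \<union> B \<noteq> {}" using walk_ne AB(1) by simp
  have "A \<union> B \<subseteq> E" using tr unfolding AB(1) trail_def by blast
  then have AE: "A \<subseteq> E" and BE: "B \<subseteq> E" by (simp_all only: Un_subset_iff)
  have finAB: "finite A" "finite B" using AB(1) by (metis List.finite_set finite_Un)+
  have finR: "finite R" using R(1) finite_subset by blast
  have card_eq: "card A = card B" using AB(3) odd by simp
  \<comment> \<open>The circuit starts and ends at \<open>a\<close> and its list has odd length, so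
    the two end terms have opposite signs.\<close>
  have deg_eq: "card {e\<in>A. z \<in> e} = card {e\<in>B. z \<in> e}" for z
    using spec[OF deg, of z] tr odd by (simp add: trail_def)
  have block: "f i e \<in> k_subsets v k" if "e \<in> E" "i \<in> {p, q}" for e i
  proof -
    have "e \<inter> R = {}" "i \<notin> R \<union> e" "finite e" "card e = 2"
      using E_outside[OF that(1)] E_card[OF that(1)] that(2) pq by (auto intro: card_ge_0_finite)
    then have "card (f i e) = k"
      using finR R(2) k unfolding f_def by (simp add: card_Un_disjoint Int_commute)
    moreover have "f i e \<subseteq> {1..v}" using E_outside(1)[OF that(1)] that(2) pq R(1) unfolding f_def by blast
    ultimately show ?thesis unfolding k_subsets_def by blast
  qed
  have inj: "inj_on (f i) E" if "i \<in> {p, q}" for i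
  proof (rule inj_onI)
    fix e e' assume "e \<in> E" "e' \<in> E" "f i e = f i e'"
    moreover have "e = f i e - R - {i}" if "e \<in> E" for e
      using E_outside[OF that] pq \<open>i \<in> {p, q}\<close> unfolding f_def by blast
    ultimately show "e = e'" by metis
  qed
  have sep: "f p ` X \<inter> f q ` Y = {}" if "X \<subseteq> E" "Y \<subseteq> E" for X Y
  proof -
    have "f p e \<noteq> f q e'" if "e \<in> E" "e' \<in> E" for e e'
      using E_outside[OF that(2)] pq unfolding f_def by blast
    then show ?thesis using that by blast
  qed
  define g where "g X i x y = card {e\<in>X. x \<in> f i e \<and> y \<in> f i e}" for X i x y
  have count: "card {b \<in> f p ` X \<union> f q ` Y. x \<in> b \<and> y \<in> b} = g X p x y + g Y q x y"
    if "X \<subseteq> E" "Y \<subseteq> E" "finite X" "finite Y" for X Y x y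
  proof -
    have "card {b \<in> f p ` X \<union> f q ` Y. x \<in> b \<and> y \<in> b} =
        card (f p ` {e\<in>X. x \<in> f p e \<and> y \<in> f p e} \<union> f q ` {e\<in>Y. x \<in> f q e \<and> y \<in> f q e})"
      by (rule arg_cong[of _ _ card]) auto
    also have "\<dots> = card (f p ` {e\<in>X. x \<in> f p e \<and> y \<in> f p e}) +
        card (f q ` {e\<in>Y. x \<in> f q e \<and> y \<in> f q e})"
      using sep[OF that(1,2)] that(3,4) by (intro card_Un_disjoint) auto
    also have "card (f p ` {e\<in>X. x \<in> f p e \<and> y \<in> f p e}) = g X p x y"
      unfolding g_def by (rule card_image, rule inj_on_subset[OF inj[of p]]) (use that in auto)
    also have "card (f q ` {e\<in>Y. x \<in> f q e \<and> y \<in> f q e}) = g Y q x y"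
      unfolding g_def by (rule card_image, rule inj_on_subset[OF inj[of q]]) (use that in auto)
    finally show ?thesis .
  qed
  \<comment> \<open>A point of \<open>R\<close> and the point \<open>i\<close> lie in every block,
    so the class sizes decide; any other point is counted by its degree.\<close>
  have single: "card {e\<in>A. z \<in> f i e} = card {e\<in>B. z \<in> f i e}" for z i
    using card_eq deg_eq[of z] by (cases "z \<in> R \<or> z = i") (auto simp: f_def)
  have zero: "g X i x y = 0" if "X \<subseteq> E" "i \<in> {p, q}" "j \<in> {p, q}" "i \<noteq> j" "x = j \<or> y = j"
    for X i j x y
  proof -
    have "j \<notin> f i e" if "e \<in> E" for e
      using E_outside[OF that] pq \<open>i \<in> {p, q}\<close> \<open>j \<in> {p, q}\<close> \<open>i \<noteq> j\<close> unfolding f_def by blast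
    then have "{e\<in>X. x \<in> f i e \<and> y \<in> f i e} = {}" using that by blast
    then show ?thesis unfolding g_def by (simp only: card.empty)
  qed
  have own: "g A i x y = g B i x y" if "x = i \<or> y = i" for i x y
    using that single[of x i] single[of y i] unfolding g_def by (auto simp: f_def)
  \<comment> \<open>Pairs avoiding \<open>p\<close> and \<open>q\<close> are counted alike in both
    families and cancel. For pairs through \<open>p\<close> or \<open>q\<close>, each family is
    balanced by itself, via \<open>own\<close> or \<open>zero\<close>.\<close>
  have bal: "g A p x y + g B q x y = g B p x y + g A q x y" for x y
  proof (cases "x \<in> {p, q} \<or> y \<in> {p, q}")
    case True
    have "g A i x y = g B i x y" if i: "i \<in> {p, q}" for i
    proof (cases "x = i \<or> y = i")
      case False
      then obtain j where "j \<in> {p, q}" "i \<noteq> j" "x = j \<or> y = j" using True by blast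
      then show ?thesis using zero[OF AE i] zero[OF BE i] by simp
    qed (rule own)
    then show ?thesis by simp
  next
    case False
    then have "g X p x y = g X q x y" for X unfolding g_def f_def by simp
    then show ?thesis by simp
  qed
  have disj: "f i ` A \<inter> f i ` B = {}" if "i \<in> {p, q}" for i
    using inj_on_image_Int[OF inj[OF that] AE BE] AB(2) by simp
  show False
  \<comment> \<open>These are the positive and negative parts of the formal product of
    \<open>A - B\<close> and \<open>p - q\<close>.\<close>
  proof (rule no_trade[OF _ D, of "f p ` A \<union> f q ` B" "f p ` B \<union> f q ` A"])
    show "f p ` A \<union> f q ` B \<subseteq> k_subsets v k" "f p ` B \<union> f q ` A \<subseteq> k_subsets v k"
      using block AE BE by blast+
    show "(f p ` B \<union> f q ` A) \<inter> D = {}" using AE BE E_notin by blast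
    show "f p ` B \<union> f q ` A \<noteq> {}" using ne by blast
    show "(f p ` A \<union> f q ` B) \<inter> (f p ` B \<union> f q ` A) = {}"
    proof -
      have *: "(X \<union> Y) \<inter> (Z \<union> T) = {}"
        if "X \<inter> Z = {}" "T \<inter> Y = {}" "X \<inter> T = {}" "Z \<inter> Y = {}" for X Y Z T :: "nat set set"
        using that by blast
      show ?thesis by (rule *[OF disj disj sep[OF AE AE] sep[OF BE BE]]) simp_all
    qed
    show "card {b \<in> f p ` A \<union> f q ` B. x \<in> b \<and> y \<in> b} =
        card {b \<in> f p ` B \<union> f q ` A. x \<in> b \<and> y \<in> b}" for x y
      by (simp only: count[OF AE BE finAB] count[OF BE AE finAB(2,1)] bal)
  qed (use k in simp)
qed

section \<open>Double counting of missing blocks\<close>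

text \<open>For a \<open>(k-1)\<close>-set \<open>S\<close>, the size of this set is the degree of
  \<open>S\<close> in the family of blocks missing from \<open>D\<close>.\<close>

definition extensions :: "nat \<Rightarrow> nat set set \<Rightarrow> nat set \<Rightarrow> nat set" where
  "extensions v D S = {y \<in> {1..v} - S. insert y S \<notin> D}"

lemma card_k_subsets: "card (k_subsets v k) = v choose k"
  using n_subsets[of "{1..v}" k] unfolding k_subsets_def by simp

lemma card_distinct_pairs:
  assumes "finite Y"
  shows "card {(p, q). p \<in> Y \<and> q \<in> Y \<and> p \<noteq> q} = card Y * (card Y - 1)"
proof -
  have "{(p, q). p \<in> Y \<and> q \<in> Y \<and> p \<noteq> q} = (SIGMA p:Y. Y - {p})" by auto
  also have "card \<dots> = (\<Sum>p\<in>Y. card (Y - {p}))" using assms by (intro card_SigmaI) auto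
  also have "\<dots> = card Y * (card Y - 1)" using assms by simp
  finally show ?thesis .
qed

text \<open>Counts the pairs of a missing block and a \<open>(k-1)\<close>-subset of it; each block
  has \<open>k\<close> such subsets.\<close>

lemma sum_card_extensions:
  assumes "1 \<le> k" "D \<subseteq> k_subsets v k"
  shows "(\<Sum>S\<in>k_subsets v (k - 1). card (extensions v D S)) = k * ((v choose k) - card D)"
proof -
  let ?C = "k_subsets v k - D"
  have "card {b\<in>?C. S \<subseteq> b} = card (extensions v D S)" if S: "S \<in> k_subsets v (k - 1)" for S
  proof -
    have fS: "finite S" "card S = k - 1" "S \<subseteq> {1..v}"
      using S finite_subset unfolding k_subsets_def by auto
    have "{b\<in>?C. S \<subseteq> b} = (\<lambda>y. insert y S) ` extensions v D S"
    proof (intro equalityI subsetI)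
      fix b assume b: "b \<in> {b\<in>?C. S \<subseteq> b}"
      then have fb: "finite b" "card b = k" "b \<subseteq> {1..v}"
        using finite_subset unfolding k_subsets_def by auto
      then have "card (b - S) = 1" using b fS assms(1) by (simp add: card_Diff_subset)
      then obtain y where "b - S = {y}" by (meson card_1_singletonE)
      then have "b = insert y S" "y \<notin> S" using b by auto
      then show "b \<in> (\<lambda>y. insert y S) ` extensions v D S"
        using b fb unfolding extensions_def by auto
    next
      fix b assume "b \<in> (\<lambda>y. insert y S) ` extensions v D S"
      then show "b \<in> {b\<in>?C. S \<subseteq> b}"
        using fS assms(1) unfolding extensions_def k_subsets_def by auto
    qed
    moreover have "inj_on (\<lambda>y. insert y S) (extensions v D S)"
      unfolding inj_on_def extensions_def by blast
    ultimately show ?thesis using card_image by metis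
  qed
  then have "(\<Sum>S\<in>k_subsets v (k - 1). card (extensions v D S)) =
      (\<Sum>S\<in>k_subsets v (k - 1). card {b\<in>?C. S \<subseteq> b})" by simp
  also have "\<dots> = k * card ?C"
  proof (rule sum_multicount)
    show "\<forall>b\<in>?C. card {S\<in>k_subsets v (k - 1). S \<subseteq> b} = k"
    proof
      fix b assume "b \<in> ?C"
      then have b: "finite b" "card b = k" "b \<subseteq> {1..v}"
        using finite_subset unfolding k_subsets_def by auto
      have "{S\<in>k_subsets v (k - 1). S \<subseteq> b} = {S. S \<subseteq> b \<and> card S = k - 1}"
        using b unfolding k_subsets_def by auto
      then show "card {S\<in>k_subsets v (k - 1). S \<subseteq> b} = k"
        using n_subsets[OF b(1), of "k - 1"] b(2) assms(1) binomial_symmetric[of "k - 1" k] by simp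
    qed
  qed (use finite_k_subsets in auto)
  also have "card ?C = (v choose k) - card D"
    using assms(2) card_k_subsets finite_k_subsets by (simp add: card_Diff_subset finite_subset)
  finally show ?thesis .
qed

text \<open>Triples \<open>(S, p, q)\<close> in \<open>?W\<close> are counted against triples
  \<open>(R, p, q)\<close> in \<open>?Z\<close> with \<open>R\<close> inside \<open>S\<close>. Each
  member of \<open>?W\<close> lies above \<open>(k - 1) choose (k - 3)\<close> members of
  \<open>?Z\<close>; conversely, the sets \<open>S\<close> above a given \<open>(R, p, q)\<close>
  are edges of its link graph.\<close>

lemma sum_extension_pairs_le:
  assumes k: "3 \<le> k" "k < v" and D: "defining_set v k D"
  shows "3 * (\<Sum>S\<in>k_subsets v (k - 1). card (extensions v D S) * (card (extensions v D S) - 1))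
    \<le> (v choose (k - 1)) * (8 * (v - k) + 2)"
proof -
  let ?Y = "extensions v D"
  let ?W = "SIGMA S:k_subsets v (k - 1). {(p, q). p \<in> ?Y S \<and> q \<in> ?Y S \<and> p \<noteq> q}"
  let ?Z = "SIGMA R:k_subsets v (k - 3). {(p, q). p \<in> {1..v} - R \<and> q \<in> {1..v} - R \<and> p \<noteq> q}"
  let ?rel = "\<lambda>w z. snd w = snd z \<and> fst z \<subseteq> fst w"
  have finY: "finite (?Y S)" for S unfolding extensions_def by simp
  have pairs_fin: "finite {(p, q). p \<in> X \<and> q \<in> X \<and> p \<noteq> q}" if "finite X" for X :: "nat set"
    by (rule finite_subset[of _ "X \<times> X"]) (use that in auto)
  have cW: "card ?W = (\<Sum>S\<in>k_subsets v (k - 1). card (?Y S) * (card (?Y S) - 1))"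
    using finite_k_subsets pairs_fin[OF finY] finY by (simp add: card_SigmaI card_distinct_pairs)
  have finW: "finite ?W" using finite_k_subsets pairs_fin[OF finY] by (intro finite_SigmaI)
  have finZ: "finite ?Z" by (intro finite_SigmaI finite_k_subsets pairs_fin) simp
  have "card ?Z = (\<Sum>R\<in>k_subsets v (k - 3). (v - k + 3) * (v - k + 2))"
  proof -
    have "card ({1..v} - R) = v - k + 3" if "R \<in> k_subsets v (k - 3)" for R
      using that k finite_subset[of R "{1..v}"] unfolding k_subsets_def
      by (auto simp: card_Diff_subset)
    then have "card {(p, q). p \<in> {1..v} - R \<and> q \<in> {1..v} - R \<and> p \<noteq> q} = (v - k + 3) * (v - k + 2)"
      if "R \<in> k_subsets v (k - 3)" for R
      using that by (subst card_distinct_pairs) (simp_all del: atLeastAtMost_iff One_nat_def)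
    moreover have "card ?Z = (\<Sum>R\<in>k_subsets v (k - 3).
        card {(p, q). p \<in> {1..v} - R \<and> q \<in> {1..v} - R \<and> p \<noteq> q})"
      by (intro card_SigmaI ballI finite_k_subsets pairs_fin) simp
    ultimately show ?thesis by (simp only: cong: sum.cong)
  qed
  then have cZ: "card ?Z = (v choose (k - 3)) * ((v - k + 3) * (v - k + 2))"
    by (simp add: card_k_subsets)
  have "card {z\<in>?Z. ?rel w z} = (k - 1) choose (k - 3)" if w: "w \<in> ?W" for w
  proof -
    obtain S p q where [simp]: "w = (S, p, q)" by (cases w)
    have S: "finite S" "card S = k - 1" "S \<subseteq> {1..v}"
      using w finite_subset unfolding k_subsets_def by auto
    have "{z\<in>?Z. ?rel w z} = (\<lambda>R. (R, p, q)) ` {R. R \<subseteq> S \<and> card R = k - 3}"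
      using w S unfolding k_subsets_def extensions_def by auto
    then show ?thesis
      using n_subsets[OF S(1), of "k - 3"] S(2) by (simp add: card_image inj_on_def)
  qed
  then have "card ?W * ((k - 1) choose (k - 3)) = (\<Sum>w\<in>?W. card {z\<in>?Z. ?rel w z})" by simp
  also have "\<dots> = (\<Sum>z\<in>?Z. card {w\<in>?W. ?rel w z})"
    using finW finZ by (intro sum_multicount_gen) auto
  finally have "3 * (card ?W * ((k - 1) choose (k - 3))) = (\<Sum>z\<in>?Z. 3 * card {w\<in>?W. ?rel w z})"
    by (simp add: sum_distrib_left)
  also have "\<dots> \<le> (\<Sum>z\<in>?Z. 4 * (v - k) + 1)"
  proof (rule sum_mono)
    fix z assume z: "z \<in> ?Z"
    obtain R p q where [simp]: "z = (R, p, q)" by (cases z)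
    let ?V = "{1..v} - R - {p, q}"
    let ?E = "{e. e \<subseteq> ?V \<and> card e = 2 \<and> insert p (R \<union> e) \<notin> D \<and> insert q (R \<union> e) \<notin> D}"
    have R: "finite R" "R \<subseteq> {1..v}" "card R = k - 3"
      and pq: "p \<in> {1..v} - R" "q \<in> {1..v} - R" "p \<noteq> q"
      using z finite_subset unfolding k_subsets_def by auto
    have "card ?V = card ({1..v} - R) - card {p, q}" using pq by (intro card_Diff_subset) auto
    then have cV: "card ?V = v - k + 1" using R k pq(3) by (simp add: card_Diff_subset)
    then have "?V \<noteq> {}" by (metis card.empty add_is_0 one_neq_zero)
    then have "3 * card ?E + 3 \<le> 4 * card ?V"
      using link_even_circuit_free[OF k(1) D R(2,3) pq]
      by (intro even_circuit_free_card_edges) auto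
    \<comment> \<open>With \<open>R\<close>, \<open>p\<close>, \<open>q\<close> fixed,
      \<open>S\<close> is determined by the edge \<open>S - R\<close>.\<close>
    moreover have "card {w\<in>?W. ?rel w z} \<le> card ?E"
    proof (rule card_inj_on_le[of "\<lambda>w. fst w - R"])
      show "inj_on (\<lambda>w. fst w - R) {w\<in>?W. ?rel w z}"
      proof (rule inj_onI)
        fix w w' assume "w \<in> {w\<in>?W. ?rel w z}" "w' \<in> {w\<in>?W. ?rel w z}" "fst w - R = fst w' - R"
        then have "R \<subseteq> fst w" "R \<subseteq> fst w'" "fst w - R = fst w' - R" "snd w = snd w'" by simp_all
        then show "w = w'" by (metis Diff_partition prod_eqI)
      qed
      show "(\<lambda>w. fst w - R) ` {w\<in>?W. ?rel w z} \<subseteq> ?E"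
      proof (rule image_subsetI)
        fix w assume w: "w \<in> {w\<in>?W. ?rel w z}"
        obtain S where [simp]: "w = (S, p, q)" using w by (cases w) auto
        have S: "S \<subseteq> {1..v}" "card S = k - 1" "R \<subseteq> S" "p \<in> ?Y S" "q \<in> ?Y S"
          using w unfolding k_subsets_def by auto
        have "card (S - R) = 2" using S R k by (simp add: card_Diff_subset)
        moreover have "R \<union> (S - R) = S" using S(3) by blast
        ultimately show "fst w - R \<in> ?E" using S unfolding extensions_def by auto
      qed
      show "finite ?E" by (rule finite_subset[of _ "Pow {1..v}"]) auto
    qed
    \<comment> \<open>The constant is \<open>4 * (v - k + 1) - 3\<close>.\<close>
    ultimately show "3 * card {w\<in>?W. ?rel w z} \<le> 4 * (v - k) + 1" using cV by simp
  qed
  finally have le: "3 * (card ?W * ((k - 1) choose (k - 3))) \<le> card ?Z * (4 * (v - k) + 1)"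
    by (simp only: sum_constant of_nat_id)
  have "(v - k + 3) * (v - k + 2) = 2 * ((v - k + 3) choose 2)"
  proof -
    have "(v - k + 3) choose 2 = (v - k + 3) * (v - k + 2) div 2" by (subst choose_two) simp
    moreover have "even ((v - k + 3) * (v - k + 2))" by (simp del: even_diff_nat)
    ultimately show ?thesis by (simp only: dvd_mult_div_cancel)
  qed
  then have "card ?Z = 2 * ((v choose (k - 3)) * ((v - k + 3) choose 2))"
    unfolding cZ by (simp only: mult.left_commute)
  \<comment> \<open>Both sides count chains of a \<open>(k-3)\<close>-set inside a
    \<open>(k-1)\<close>-set; this form exposes the factor to be cancelled.\<close>
  also have "(v choose (k - 3)) * ((v - k + 3) choose 2) =
      (v choose (k - 1)) * ((k - 1) choose (k - 3))"
  proof -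
    have "v - (k - 3) = v - k + 3" "k - 1 - (k - 3) = 2" using k by simp_all
    then show ?thesis using choose_mult[of "k - 3" "k - 1" v] k by simp
  qed
  finally have Z: "card ?Z = 2 * ((v choose (k - 1)) * ((k - 1) choose (k - 3)))" .
  have arith: "2 * (a * b) * (4 * m + 1) = a * (8 * m + 2) * b" for a b m :: nat
    by (simp add: algebra_simps)
  have "(3 * card ?W) * ((k - 1) choose (k - 3)) \<le>
      ((v choose (k - 1)) * (8 * (v - k) + 2)) * ((k - 1) choose (k - 3))"
    using le unfolding Z arith by (simp only: mult.assoc)
  then have "3 * card ?W \<le> (v choose (k - 1)) * (8 * (v - k) + 2)"
    by (rule mult_right_le_imp_le) (simp add: zero_less_binomial)
  then show ?thesis by (simp only: cW)
qed

section \<open>Convexity and the final bound\<close>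

text \<open>The variance is nonnegative, so the mean \<open>m\<close> satisfies
  \<open>m ^ 2 - m \<le> c\<close> and is at most the larger root of that quadratic.\<close>

lemma quadratic_mean_bound:
  fixes d :: "'a \<Rightarrow> nat" and c :: real
  assumes "finite A" "A \<noteq> {}" "real (\<Sum>x\<in>A. d x * (d x - 1)) \<le> real (card A) * c"
  shows "real (\<Sum>x\<in>A. d x) \<le> real (card A) * (1 + sqrt (1 + 4 * c)) / 2"
proof -
  define M where "M = real (card A)"
  define m where "m = real (\<Sum>x\<in>A. d x) / M"
  have M: "0 < M" using assms by (simp add: M_def card_gt_0_iff)
  have dm: "(\<Sum>x\<in>A. real (d x)) = m * M" using M by (simp add: m_def)
  have nat: "real (n * (n - 1)) = real n * real n - real n" for n
    by (cases n) (simp_all add: algebra_simps)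
  have "0 \<le> (\<Sum>x\<in>A. (real (d x) - m) ^ 2)" by (rule sum_nonneg) simp
  also have "\<dots> = (\<Sum>x\<in>A. real (d x * (d x - 1)) + (1 - 2 * m) * real (d x) + m ^ 2)"
    unfolding nat by (rule sum.cong) (simp_all add: power2_eq_square algebra_simps)
  also have "\<dots> = real (\<Sum>x\<in>A. d x * (d x - 1)) + (1 - 2 * m) * (m * M) + M * m ^ 2"
    by (simp add: sum.distrib dm M_def flip: sum_distrib_left)
  also have "\<dots> \<le> M * c + (1 - 2 * m) * (m * M) + M * m ^ 2" using assms(3) by (simp add: M_def)
  also have "\<dots> = M * (c + m - m ^ 2)" by (simp add: power2_eq_square algebra_simps)
  finally have "m ^ 2 - m \<le> c" using M by (simp add: zero_le_mult_iff)
  then have "(2 * m - 1) ^ 2 \<le> 1 + 4 * c" by (simp add: power2_eq_square algebra_simps)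
  then have "2 * m - 1 \<le> sqrt (1 + 4 * c)" by (rule real_le_rsqrt)
  then have "m * M \<le> (1 + sqrt (1 + 4 * c)) / 2 * M" using M by (intro mult_right_mono) auto
  then show ?thesis using M by (simp add: m_def M_def mult.commute)
qed

text \<open>The mean bound is applied to the degrees of the \<open>(k-1)\<close>-sets with
  \<open>c = (8 * n + 2) / 3\<close>, which produces the radicand. Their sum is \<open>k\<close>
  times the number of missing blocks.\<close>

lemma card_defining_set_ge:
  assumes k: "3 \<le> k" "k < v" and D: "defining_set v k D"
  shows "real (card D) \<ge> real (v choose k) *
    (1 - (1 + sqrt ((32 * (real v - real k) + 11) / 3)) / (2 * (real v - real k + 1)))"
proof -
  define n where "n = real v - real k"
  define s where "s = 1 + sqrt ((32 * n + 11) / 3)"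
  let ?A = "k_subsets v (k - 1)"
  let ?d = "\<lambda>S. card (extensions v D S)"
  have n: "0 < n" "real (v - k) = n" using k by (simp_all add: n_def of_nat_diff)
  have Dsub: "D \<subseteq> k_subsets v k" using D by (simp add: defining_set_def)
  have le: "card D \<le> v choose k"
    using card_mono[OF finite_k_subsets Dsub] by (simp add: card_k_subsets)
  have "v choose (k - 1) \<noteq> 0" using k by simp
  then have ne: "?A \<noteq> {}" using card_k_subsets[of v "k - 1"] by auto
  have "3 * real (\<Sum>S\<in>?A. ?d S * (?d S - 1)) \<le> real (card ?A) * (8 * n + 2)"
  proof -
    have "real (8 * (v - k) + 2) = 8 * n + 2" using n by simp
    then show ?thesis
      using of_nat_mono[OF sum_extension_pairs_le[OF k D], where 'a = real]
      by (simp only: of_nat_mult of_nat_numeral card_k_subsets)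
  qed
  then have "real (\<Sum>S\<in>?A. ?d S) \<le> real (card ?A) * (1 + sqrt (1 + 4 * ((8 * n + 2) / 3))) / 2"
    using finite_k_subsets ne by (intro quadratic_mean_bound) auto
  also have "1 + 4 * ((8 * n + 2) / 3) = (32 * n + 11) / 3" by (simp add: field_simps)
  finally have "real (\<Sum>S\<in>?A. ?d S) \<le> real (card ?A) * s / 2" unfolding s_def .
  moreover have "real (\<Sum>S\<in>?A. ?d S) = real k * (real (v choose k) - real (card D))"
    using sum_card_extensions[OF _ Dsub] k le by (simp add: of_nat_diff)
  ultimately have "real k * (real (v choose k) - real (card D)) \<le> real (v choose (k - 1)) * s / 2"
    by (simp add: card_k_subsets)
  \<comment> \<open>Turns the bound relative to the number of \<open>(k-1)\<close>-sets into one
    relative to the number of blocks.\<close>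
  moreover have "(v choose k) * k = (v choose (k - 1)) * (v - k + 1)"
  proof -
    have "(v - (k - 1)) * (v choose (k - 1)) = v * ((v - 1) choose (k - 1))"
      by (rule binomial_absorb_comp)
    moreover have "k * (v choose k) = v * ((v - 1) choose (k - 1))"
      using times_binomial_minus1_eq[of k v] k by simp
    moreover have "v - (k - 1) = v - k + 1" using k by simp
    ultimately show ?thesis by (metis mult.commute)
  qed
  then have "real (v choose k) * real k = real (v choose (k - 1)) * (n + 1)"
    using n by (metis of_nat_mult of_nat_add of_nat_1)
  then have "real (v choose (k - 1)) = real (v choose k) * real k / (n + 1)"
    using n by (simp add: field_simps)
  ultimately have "real k * (real (v choose k) - real (card D)) \<le>
      real (v choose k) * real k / (n + 1) * s / 2" by (simp only:)
  also have "\<dots> = real k * (real (v choose k) * (s / (2 * (n + 1))))"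
    by (simp add: ac_simps)
  finally have "real k * (real (v choose k) - real (card D)) \<le>
      real k * (real (v choose k) * (s / (2 * (n + 1))))" .
  then have "real (v choose k) - real (card D) \<le> real (v choose k) * (s / (2 * (n + 1)))"
    by (rule mult_left_le_imp_le) (use k in simp)
  then show ?thesis by (simp add: s_def n_def algebra_simps)
qed

text \<open>From \<open>1 \<le> n\<close> the radicand is at most \<open>16 * n\<close>; the
  numerator is bounded generously by \<open>6 * sqrt n\<close>, which over \<open>2 * n\<close>
  leaves the constant 3.\<close>

lemma error_term_le:
  fixes n :: real
  assumes "1 \<le> n"
  shows "(1 + sqrt ((32 * n + 11) / 3)) / (2 * (n + 1)) \<le> 3 * n powr (- 1 / 2)"
proof -
  have n: "0 < sqrt n" "sqrt n * sqrt n = n" using assms by auto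
  have "sqrt ((32 * n + 11) / 3) \<le> sqrt (16 * n)" using assms by (intro real_sqrt_le_mono) simp
  also have "\<dots> = 4 * sqrt n" by (simp add: real_sqrt_mult)
  finally have "sqrt ((32 * n + 11) / 3) \<le> 4 * sqrt n" .
  moreover have "1 \<le> sqrt n" using assms by simp
  ultimately have "1 + sqrt ((32 * n + 11) / 3) \<le> 6 * sqrt n" by linarith
  then have "(1 + sqrt ((32 * n + 11) / 3)) / (2 * (n + 1)) \<le> 6 * sqrt n / (2 * n)"
    using assms by (intro frac_le) auto
  also have "\<dots> = 3 / sqrt n" using n by (simp add: field_simps)
  also have "\<dots> = 3 * n powr (- 1 / 2)"
    using assms by (simp add: powr_minus_divide powr_half_sqrt)
  finally show ?thesis .
qed

text \<open>The \<open>principal\<close> filter makes the implied constant uniform over all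
  admissible pairs \<open>(v, k)\<close>, not only eventually.\<close>

theorem theorem3p5:
  "(\<forall>(v::nat) (k::nat) (D::nat set set).
      3 \<le> k \<and> k < v \<and> defining_set v k D \<longrightarrow>
      real (card D) \<ge> real (v choose k) *
        (1 - (1 + sqrt ((32 * (real v - real k) + 11) / 3)) / (2 * (real v - real k + 1))))
   \<and>
   (\<exists>E :: nat \<times> nat \<Rightarrow> real.
      E \<in> O[principal {(v, k). 3 \<le> k \<and> k < v}](\<lambda>(v, k). (real v - real k) powr (- 1 / 2)) \<and>
      (\<forall>(v::nat) (k::nat). 3 \<le> k \<and> k < v \<longrightarrow>
         real (v choose k) *
           (1 - (1 + sqrt ((32 * (real v - real k) + 11) / 3)) / (2 * (real v - real k + 1)))
         = real (v choose k) * (1 - E (v, k))))"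
proof (intro conjI allI impI)
  fix v k :: nat and D :: "nat set set"
  assume "3 \<le> k \<and> k < v \<and> defining_set v k D"
  then show "real (card D) \<ge> real (v choose k) *
        (1 - (1 + sqrt ((32 * (real v - real k) + 11) / 3)) / (2 * (real v - real k + 1)))"
    using card_defining_set_ge by blast
next
  \<comment> \<open>The witness is the exact subtracted term, so the required equality is
    immediate.\<close>
  let ?E = "\<lambda>(v, k). (1 + sqrt ((32 * (real v - real k) + 11) / 3)) / (2 * (real v - real k + 1))"
  have "?E \<in> O[principal {(v, k). 3 \<le> k \<and> k < v}](\<lambda>(v, k). (real v - real k) powr (- 1 / 2))"
  proof (rule bigoI[where c = 3], unfold eventually_principal, intro ballI)
    fix z :: "nat \<times> nat" assume "z \<in> {(v, k). 3 \<le> k \<and> k < v}"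
    then obtain v k where z: "z = (v, k)" "k < v" by blast
    then have n: "1 \<le> real v - real k" by linarith
    then have "0 \<le> ?E z" using z by simp
    then show "norm (?E z) \<le> 3 * norm ((\<lambda>(v, k). (real v - real k) powr (- 1 / 2)) z)"
      using error_term_le[OF n] z by simp
  qed
  then show "\<exists>E :: nat \<times> nat \<Rightarrow> real.
      E \<in> O[principal {(v, k). 3 \<le> k \<and> k < v}](\<lambda>(v, k). (real v - real k) powr (- 1 / 2)) \<and>
      (\<forall>(v::nat) (k::nat). 3 \<le> k \<and> k < v \<longrightarrow>
         real (v choose k) *
           (1 - (1 + sqrt ((32 * (real v - real k) + 11) / 3)) / (2 * (real v - real k + 1)))
         = real (v choose k) * (1 - E (v, k)))"
    by (intro exI[of _ ?E]) simp
qed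

end
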